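(* For each positive integer $n$, \[|\mathrm{VHC}(\operatorname{Av}_n(312,321))|=\sum_{k=0}^{\lfloor (n-1)/2\rfloor}\frac{1}{2k+1}\binom{n-k-1}{k}\binom{n}{2k}.\]
   Context: $S_n$ is the set of permutations of $[n]$; $\operatorname{Av}_n(312,321)$ is the set of $\pi\in S_n$ having no subsequence in the same relative order as $312$ or as $321$. Valid hook configurations. For $\pi=\pi_1\cdots\pi_n$, a descent is $i\in[n-1]$ with $\pi_i>\pi_{i+1}$, and $(i,\pi_i)$ is a descent top of the plot $\{(i,\pi_i)\}$. A hook is determined by $i<j$ with $\pi_i<\pi_j$: vertical segment from $(i,\pi_i)$ up to $(i,\pi_j)$, then horizontal segment to $(j,\pi_j)$; southwest endpoint $(i,\pi_i)$, northeast endpoint $(j,\pi_j)$. If $\pi$ has descents $d_1<\cdots<d_k$, a valid hook configuration is a tuple $(H_1,\dots,H_k)$ of hooks such that (1) $H_i$ has southwest endpoint $(d_i,\pi_{d_i})$; (2) no point of the plot lies directly above a hook; (3) hooks do not intersect or overlap except that the northeast endpoint of one may be the southwest endpoint of another. $\mathrm{VHC}(\pi)$ is the set of these (configurations of distinct permutations are distinct; an increasing permutation has exactly one, with no hooks); $\mathrm{VHC}(A)=\bigcup_{\pi\in A}\mathrm{VHC}(\pi)$. *)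

theory Defs
  imports Complex_Main "HOL-Library.Sublist" "HOL-Combinatorics.Multiset_Permutations"
begin

text \<open>
  A permutation of \<open>[n]\<close> is given by its one-line notation, a list; the members of \<open>S\<^sub>n\<close> are the
  elements of \<^term>\<open>permutations_of_set {1..n}\<close>. Positions are numbered from 1.
\<close>

definition entry :: "nat list \<Rightarrow> nat \<Rightarrow> nat" where
  "entry p i = p ! (i - 1)"

definition same_relative_order :: "nat list \<Rightarrow> nat list \<Rightarrow> bool" where
  "same_relative_order xs ys \<longleftrightarrow> length xs = length ys \<and>
     (\<forall>a < length xs. \<forall>b < length xs. xs ! a < xs ! b \<longleftrightarrow> ys ! a < ys ! b)"

definition contains_pattern :: "nat list \<Rightarrow> nat list \<Rightarrow> bool" where
  "contains_pattern p s \<longleftrightarrow> (\<exists>xs. subseq xs p \<and> same_relative_order xs s)"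

definition Av :: "nat \<Rightarrow> nat list set \<Rightarrow> nat list set" where
  "Av n B = {p \<in> permutations_of_set {1..n}. \<forall>s\<in>B. \<not> contains_pattern p s}"

definition plot_point :: "nat list \<Rightarrow> nat \<Rightarrow> real \<times> real" where
  "plot_point p i = (real i, real (entry p i))"

definition plot :: "nat list \<Rightarrow> (real \<times> real) set" where
  "plot p = plot_point p ` {1..length p}"

definition descents :: "nat list \<Rightarrow> nat set" where
  "descents p = {i. 1 \<le> i \<and> i < length p \<and> entry p i > entry p (i + 1)}"

text \<open>
  A hook is encoded by the pair \<open>(i, j)\<close> of positions of its endpoints; \<open>hook_curve\<close> is the
  subset of the plane that it occupies.
\<close>

definition is_hook :: "nat list \<Rightarrow> nat \<times> nat \<Rightarrow> bool" where
  "is_hook p h \<longleftrightarrow> 1 \<le> fst h \<and> fst h < snd h \<and> snd h \<le> length p \<and>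
     entry p (fst h) < entry p (snd h)"

definition sw_endpoint :: "nat list \<Rightarrow> nat \<times> nat \<Rightarrow> real \<times> real" where
  "sw_endpoint p h = plot_point p (fst h)"

definition ne_endpoint :: "nat list \<Rightarrow> nat \<times> nat \<Rightarrow> real \<times> real" where
  "ne_endpoint p h = plot_point p (snd h)"

definition hook_curve :: "nat list \<Rightarrow> nat \<times> nat \<Rightarrow> (real \<times> real) set" where
  "hook_curve p h =
     {fst (sw_endpoint p h)} \<times> {snd (sw_endpoint p h)..snd (ne_endpoint p h)} \<union>
     {fst (sw_endpoint p h)..fst (ne_endpoint p h)} \<times> {snd (ne_endpoint p h)}"

definition directly_above :: "real \<times> real \<Rightarrow> (real \<times> real) set \<Rightarrow> bool" where
  "directly_above z C \<longleftrightarrow> (\<exists>w\<in>C. fst w = fst z \<and> snd w < snd z)"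

definition hooks_compatible :: "nat list \<Rightarrow> nat \<times> nat \<Rightarrow> nat \<times> nat \<Rightarrow> bool" where
  "hooks_compatible p g h \<longleftrightarrow>
     (\<forall>z \<in> hook_curve p g \<inter> hook_curve p h.
        (z = ne_endpoint p g \<and> z = sw_endpoint p h) \<or>
        (z = sw_endpoint p g \<and> z = ne_endpoint p h))"

definition valid_hook_configuration :: "nat list \<Rightarrow> (nat \<times> nat) list \<Rightarrow> bool" where
  "valid_hook_configuration p hs \<longleftrightarrow>
     (\<forall>h \<in> set hs. is_hook p h) \<and>
     length hs = card (descents p) \<and>
     (\<forall>a < length hs.
        sw_endpoint p (hs ! a) = plot_point p (sorted_list_of_set (descents p) ! a)) \<and>
     (\<forall>z \<in> plot p. \<forall>h \<in> set hs. \<not> directly_above z (hook_curve p h)) \<and>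
     (\<forall>a < length hs. \<forall>b < length hs. a \<noteq> b \<longrightarrow> hooks_compatible p (hs ! a) (hs ! b))"

text \<open>
  The permutation is recorded along with the tuple of hooks, since the same tuple of position
  pairs may be a valid hook configuration of several permutations.
\<close>

definition VHC :: "nat list \<Rightarrow> (nat list \<times> (nat \<times> nat) list) set" where
  "VHC p = {(p, hs) | hs. valid_hook_configuration p hs}"

definition VHC_of :: "nat list set \<Rightarrow> (nat list \<times> (nat \<times> nat) list) set" where
  "VHC_of A = (\<Union>p\<in>A. VHC p)"

end

theory Submission
  imports Defs
begin

text \<open>
  A permutation \<open>\<pi>\<close> of \<open>[n]\<close> avoids 312 and 321 iff \<open>\<pi>\<^sub>i \<le> i + 1\<close> for all \<open>i\<close>, and then it is
  determined by the set of positions with \<open>\<pi>\<^sub>i = i + 1\<close>; it is a direct sum of blocks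
  \<open>2 3 \<dots> m 1\<close>. In a valid hook configuration the northeast endpoints avoid the last
  positions of the blocks of size at least 2, and the hooks form a noncrossing matching, which is
  recovered from the set of its right endpoints by letting each hook end where the number of open
  hooks first drops back. So configurations correspond to words over four letters (is
  \<open>\<pi>\<^sub>i = i + 1\<close>, is \<open>i\<close> a northeast endpoint) that satisfy a ballot condition. The prefixes
  with a given number of opened and closed hooks have a product formula when they end inside a
  block, and a difference of two products otherwise; both follow by induction on the length.
\<close>

subsection \<open>Counting ballot words\<close>

text \<open>
  Words are stored in reverse, the head being the last letter. The first component of a letter
  says \<open>\<pi>\<^sub>i = i + 1\<close>, the second that a hook ends at \<open>i\<close>. A hook opened by the descent at \<open>i\<close>
  is counted by \<open>ups\<close> from position \<open>i + 1\<close> on, where no hook can end.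
\<close>

fun in_block :: "(bool \<times> bool) list \<Rightarrow> bool" where
  "in_block [] \<longleftrightarrow> False"
| "in_block ((b, c) # w) \<longleftrightarrow> b"

fun ups :: "(bool \<times> bool) list \<Rightarrow> nat" where
  "ups [] = 0"
| "ups ((b, c) # w) = ups w + (if in_block w \<and> \<not> b then 1 else 0)"

fun closers :: "(bool \<times> bool) list \<Rightarrow> nat" where
  "closers [] = 0"
| "closers ((b, c) # w) = closers w + (if c then 1 else 0)"

text \<open>This is the ballot condition. A letter that closes a hook must not leave a block, so it
  keeps \<open>ups\<close> unchanged, and the strict \<open>closers w < ups w\<close> before it
  preserves the weak inequality after it.\<close>

fun admissible :: "(bool \<times> bool) list \<Rightarrow> bool" where
  "admissible [] \<longleftrightarrow> True"
| "admissible ((b, c) # w) \<longleftrightarrow>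
     admissible w \<and> (c \<longrightarrow> closers w < ups w \<and> \<not> (in_block w \<and> \<not> b))"

section \<open>Recursions for the numbers of admissible words\<close>

definition words :: "nat \<Rightarrow> bool \<Rightarrow> nat \<Rightarrow> nat \<Rightarrow> (bool \<times> bool) list set" where
  "words n s k j =
     {w. length w = n \<and> admissible w \<and> in_block w = s \<and> ups w = k \<and> closers w = j}"

lemma closers_le_ups: "admissible w \<Longrightarrow> closers w \<le> ups w"
  by (induction w rule: admissible.induct) auto

lemma ups_le_length: "ups w \<le> length w"
  by (induction w rule: ups.induct) auto

lemma words_empty: "k < j \<Longrightarrow> words n s k j = {}"
  using closers_le_ups by (fastforce simp: words_def)

lemma finite_words [simp]: "finite (words n s k j)"
proof (rule finite_subset)
  show "words n s k j \<subseteq> {w. set w \<subseteq> UNIV \<and> length w = n}"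
    by (auto simp: words_def)
qed (rule finite_lists_length_eq, simp)

lemma words_0: "words 0 s k j = (if \<not> s \<and> k = 0 \<and> j = 0 then {[]} else {})"
  by (auto simp: words_def)

lemma in_words_Suc_cases:
  assumes "w \<in> words (Suc n) s k j"
  obtains c v where "w = (s, c) # v" "length v = n" "admissible ((s, c) # v)"
    "ups ((s, c) # v) = k" "closers ((s, c) # v) = j"
proof -
  from assms obtain x v where w: "w = x # v" "length v = n"
    by (auto simp: words_def length_Suc_conv)
  with assms show ?thesis using that by (cases x) (auto simp: words_def)
qed

text \<open>A letter inside a block opens no hook, so the shorter word has the same \<open>k\<close>
  and may end inside or outside a block. The index set of the union has at most one element; it
  stands for \<open>j - 1\<close> and is empty when nothing can be closed.\<close>

lemma words_Suc_True:
  "words (Suc n) True k j =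
     Cons (True, False) ` (words n True k j \<union> words n False k j) \<union>
     Cons (True, True) ` (\<Union>i\<in>{i. Suc i = j \<and> i < k}. words n True k i \<union> words n False k i)"
    (is "?L = ?R")
proof
  show "?L \<subseteq> ?R"
  proof
    fix w assume "w \<in> ?L"
    then show "w \<in> ?R"
      by (rule in_words_Suc_cases) (auto simp: words_def image_iff split: if_splits)
  qed
  show "?R \<subseteq> ?L" by (auto simp: words_def)
qed

text \<open>Leaving a block opens a hook and forbids closing one at the same letter. Hence
  predecessors inside a block have one hook fewer and occur only below
  \<open>(False, False)\<close>.\<close>

lemma words_Suc_False:
  "words (Suc n) False k j =
     Cons (False, False) ` (words n False k j \<union> (\<Union>i\<in>{i. Suc i = k}. words n True i j)) \<union>
     Cons (False, True) ` (\<Union>i\<in>{i. Suc i = j \<and> i < k}. words n False k i)"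
    (is "?L = ?R")
proof
  show "?L \<subseteq> ?R"
  proof
    fix w assume "w \<in> ?L"
    then show "w \<in> ?R"
      by (rule in_words_Suc_cases) (auto simp: words_def image_iff split: if_splits)
  qed
  show "?R \<subseteq> ?L" by (auto simp: words_def)
qed

lemma card_image_Cons [simp]: "card (Cons x ` A) = card A"
  by (intro card_image) (auto simp: inj_on_def)

lemma card_words_disjoint:
  "s \<noteq> t \<Longrightarrow> card (words n s k j \<union> words n t k' j') = card (words n s k j) + card (words n t k' j')"
  by (intro card_Un_disjoint finite_words) (auto simp: words_def)

lemma image_Cons_Un_disjoint:
  "x \<noteq> y \<Longrightarrow> finite A \<Longrightarrow> finite B \<Longrightarrow> card (Cons x ` A \<union> Cons y ` B) = card A + card B"
  by (subst card_Un_disjoint) auto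

lemma card_words_True_0:
  "card (words (Suc n) True k 0) = card (words n True k 0) + card (words n False k 0)"
  by (simp add: words_Suc_True card_words_disjoint)

lemma card_words_True_Suc:
  assumes "i < k"
  shows "card (words (Suc n) True k (Suc i)) =
     card (words n True k (Suc i)) + card (words n False k (Suc i)) +
     card (words n True k i) + card (words n False k i)"
proof -
  have "{i'. Suc i' = Suc i \<and> i' < k} = {i}" using assms by auto
  then show ?thesis
    by (simp add: words_Suc_True image_Cons_Un_disjoint card_words_disjoint)
qed

lemma card_words_False_0_0:
  "card (words (Suc n) False 0 0) = card (words n False 0 0)"
  by (simp add: words_Suc_False)

lemma card_words_False_Suc_0:
  "card (words (Suc n) False (Suc k) 0) = card (words n False (Suc k) 0) + card (words n True k 0)"
  by (simp add: words_Suc_False card_words_disjoint)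

lemma card_words_False_Suc_Suc:
  assumes "i \<le> k"
  shows "card (words (Suc n) False (Suc k) (Suc i)) =
     card (words n False (Suc k) (Suc i)) + card (words n True k (Suc i)) +
     card (words n False (Suc k) i)"
proof -
  have "{i'. Suc i' = Suc i \<and> i' < Suc k} = {i}" using assms by auto
  then show ?thesis
    by (simp add: words_Suc_False image_Cons_Un_disjoint card_words_disjoint)
qed

section \<open>Closed forms that satisfy the recursions\<close>

lemma binomial_absorb_up: 
  "real (Suc m) * real (n choose Suc m) = (real n - real m) * real (n choose m)"
proof (cases "m \<le> n")
  case True
  have "Suc m * (n choose Suc m) = (n - m) * (n choose m)"
  proof (cases n)
    case (Suc n')
    then show ?thesis using binomial_absorb_comp[of n m] Suc_times_binomial[of m n'] 
      by simp
  qed simp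
  then show ?thesis using True by (metis of_nat_diff of_nat_mult)
qed (simp add: binomial_eq_0)

text \<open>
  The numbers of admissible words of length \<open>n\<close> with \<open>k\<close> opened and \<open>j\<close> closed hooks that
  end outside and inside a block. They are valid for \<open>j \<le> k\<close> only: at
  \<open>j = k + 1\<close> the count is 0, as is \<open>count_inside\<close>, but \<open>count_outside\<close> is not.
\<close>

definition count_outside :: "nat \<Rightarrow> nat \<Rightarrow> nat \<Rightarrow> real" where
  "count_outside n k j = real (n choose (2 * k)) * (real ((n - k) choose j) -
     (if j = 0 then 0
      else (2 * (real n - real k) + 1) / (2 * real k + 1) * real ((n - k - 1) choose (j - 1))))"

definition count_inside :: "nat \<Rightarrow> nat \<Rightarrow> nat \<Rightarrow> real" where
  "count_inside n k j = (real k + 1 - real j) / (real k + 1) *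
     real ((n - k) choose j) * real (n choose (2 * k + 1))"

lemma count_outside_0: "count_outside n k 0 = real (n choose (2 * k))"
  by (simp add: count_outside_def)

text \<open>Pascal's rule applied to both products at once; the coefficient of the second does not
  depend on \<open>j\<close>. For \<open>k \<ge> n\<close>, positivity of \<open>k\<close> makes
  \<open>n choose (2 * k)\<close> vanish.\<close>

lemma count_outside_Suc_add:
  assumes "k > 0"
  shows "count_outside n k (Suc i) + count_outside n k i = real (n choose (2 * k)) * (real (Suc (n - k) choose Suc i) -
      (2 * (real n - real k) + 1) / (2 * real k + 1) * real ((n - k) choose i))"
proof (cases "k < n")
  case True
  then obtain M where M: "n - k = Suc M" by (metis Suc_diff_Suc)
  define c where "c = (2 * (real n - real k) + 1) / (2 * real k + 1)"
  show ?thesis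
    unfolding count_outside_def c_def[symmetric] M by (cases i) (simp_all add: algebra_simps)
next
  case False
  then have "n < 2 * k" using assms by auto
  then show ?thesis by (simp add: count_outside_def binomial_eq_0)
qed

lemma count_inside_step_0: "count_inside (Suc n) k 0 = count_inside n k 0 + count_outside n k 0"
  by (simp add: count_inside_def count_outside_def)

text \<open>Absorption expresses \<open>Z\<close> through \<open>X\<close> and \<open>Y\<close>
  through \<open>P\<close>, so every term becomes \<open>X * P\<close> times a rational function of
  \<open>N\<close>, \<open>k\<close> and \<open>i\<close>. What remains is a rational identity,
  checked by clearing denominators.\<close>

lemma count_inside_step_Suc:
  assumes "i < k"
  shows "count_inside (Suc n) k (Suc i) =
     count_inside n k (Suc i) + count_outside n k (Suc i) + count_inside n k i + count_outside n k i"
proof (cases "k \<le> n")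
  case True
  define N where "N = n - k"
  have n: "n = N + k" using True by (simp add: N_def)
  define X Y P where "X = real (n choose (2 * k))" and "Y = real (Suc N choose Suc i)" and "P = real (N choose i)"
  have 1: "real (2 * k + 1) * real (n choose (2 * k + 1)) = (real N - real k) * X"
    using binomial_absorb_up[of "2 * k" n] by (simp add: X_def n)
  have 2: "real (Suc i) * Y = real (Suc N) * P"
    unfolding Y_def P_def by (metis Suc_times_binomial of_nat_mult)
  have 3: "Suc n - k = Suc N" "n - k = N" using n by auto
  have 4: "real (N choose Suc i) = Y - P" by (simp add: Y_def P_def)
  define Z where "Z = real (n choose (2 * k + 1))"
  have 5: "real (Suc n choose (2 * k + 1)) = Z + X" by (simp add: Z_def X_def)
  have Z: "Z = (real N - real k) * X / (2 * real k + 1)" using 1 unfolding Z_def[symmetric]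
    by (simp add: field_simps)
  have Y: "Y = (real N + 1) * P / (real i + 1)" using 2 by (simp add: field_simps)
  have p: "2 * real k + 1 \<noteq> 0" "real i + 1 \<noteq> 0" "real k + 1 \<noteq> 0" by (auto simp: add_nonneg_eq_0_iff)
  have "count_inside (Suc n) k (Suc i) = (real k - real i) / (real k + 1) * Y * (Z + X)"
    unfolding count_inside_def 3 Y_def[symmetric] 5 by simp
  moreover have "count_inside n k (Suc i) = (real k - real i) / (real k + 1) * (Y - P) * Z"
    unfolding count_inside_def 3 4 Z_def[symmetric] by simp
  moreover have "count_inside n k i = (real k + 1 - real i) / (real k + 1) * P * Z"
    unfolding count_inside_def 3 P_def Z_def by simp
  moreover have "count_outside n k (Suc i) + count_outside n k i = X * (Y - (2 * real N + 1) / (2 * real k + 1) * P)"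
    using count_outside_Suc_add[of k n i] assms unfolding 3 X_def Y_def P_def by (simp add: n)
  moreover have "(real k - real i) / (real k + 1) * Y * (Z + X) =
     (real k - real i) / (real k + 1) * (Y - P) * Z + (real k + 1 - real i) / (real k + 1) * P * Z +
     X * (Y - (2 * real N + 1) / (2 * real k + 1) * P)"
    unfolding Z Y using p by (simp add: divide_simps) (simp add: algebra_simps)
  ultimately show ?thesis by simp
next
  case False
  then show ?thesis by (simp add: count_outside_def count_inside_def binomial_eq_0)
qed

lemma count_outside_step_0: "count_outside (Suc n) (Suc k) 0 = count_outside n (Suc k) 0 + count_inside n k 0"
  by (simp add: count_inside_def count_outside_def)

text \<open>The method is that of \<open>count_inside_step_Suc\<close>, now with
  \<open>N = n - Suc k\<close> and with \<open>n choose (2 * k + 1)\<close> in the role of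
  \<open>X\<close>. If \<open>k \<ge> n\<close>, each term has a binomial factor that is
  zero.\<close>

lemma count_outside_step_Suc:
  "count_outside (Suc n) (Suc k) (Suc i) =
     count_outside n (Suc k) (Suc i) + count_inside n k (Suc i) + count_outside n (Suc k) i"
proof (cases "k < n")
  case True
  define N where "N = n - Suc k"
  have n: "n = Suc (N + k)" using True by (simp add: N_def)
  define X Y P where "X = real (n choose (2 * k + 1))" and "Y = real (Suc N choose Suc i)" and "P = real (N choose i)"
  define Z where "Z = real (n choose (2 * Suc k))"
  have 1: "real (2 * k + 2) * Z = (real N - real k) * X"
    using binomial_absorb_up[of "2 * k + 1" n] by (simp add: Z_def X_def n)
  have 2: "real (Suc i) * Y = real (Suc N) * P"
    unfolding Y_def P_def by (metis Suc_times_binomial of_nat_mult)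
  have 3: "Suc n - Suc k = Suc N" "n - Suc k = N" "n - k = Suc N" using n by auto
  have 5: "real (Suc n choose (2 * Suc k)) = Z + X" by (simp add: Z_def X_def)
  have Z: "Z = (real N - real k) * X / (2 * real k + 2)" using 1
    by (simp add: field_simps)
  have Y: "Y = (real N + 1) * P / (real i + 1)" using 2 by (simp add: field_simps)
  have p: "2 * real k + 2 \<noteq> 0" "2 * real k + 3 \<noteq> 0" "real i + 1 \<noteq> 0" "real k + 1 \<noteq> 0"
    by (auto simp: add_nonneg_eq_0_iff)
  have "count_outside (Suc n) (Suc k) (Suc i) = (Z + X) * (Y - (2 * real N + 3) / (2 * real k + 3) * P)"
    unfolding count_outside_def 3 5 Y_def P_def by (simp add: n add.commute)
  moreover have "count_outside n (Suc k) (Suc i) + count_outside n (Suc k) i =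
      Z * (Y - (2 * real N + 1) / (2 * real k + 3) * P)"
    using count_outside_Suc_add[of "Suc k" n i] unfolding 3 Z_def Y_def P_def by (simp add: n)
  moreover have "count_inside n k (Suc i) = (real k - real i) / (real k + 1) * Y * X"
    unfolding count_inside_def 3 X_def Y_def by simp
  moreover have "(Z + X) * (Y - (2 * real N + 3) / (2 * real k + 3) * P) =
     Z * (Y - (2 * real N + 1) / (2 * real k + 3) * P) + (real k - real i) / (real k + 1) * Y * X"
    unfolding Z Y using p by (simp add: divide_simps) (simp add: algebra_simps)
  ultimately show ?thesis by simp
next
  case False
  then show ?thesis by (simp add: count_outside_def count_inside_def binomial_eq_0)
qed

text \<open>Each recursion mixes words ending inside and outside a block, so both formulas go
  through one induction on the length.\<close>

lemma card_words:
  "j \<le> k \<Longrightarrow> real (card (words n False k j)) = count_outside n k j \<and> real (card (words n True k j)) = count_inside n k j"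
proof (induction n arbitrary: k j)
  case 0
  then show ?case
    by (cases "k = 0") (auto simp: words_0 count_outside_def count_inside_def binomial_eq_0)
next
  case (Suc n)
  have T: "real (card (words (Suc n) True k j)) = count_inside (Suc n) k j"
  proof (cases j)
    case 0
    then show ?thesis using Suc.IH[of 0 k] by (simp add: card_words_True_0 count_inside_step_0)
  next
    case (Suc i)
    with Suc.prems show ?thesis using Suc.IH[of i k] Suc.IH[of j k]
      by (simp add: card_words_True_Suc count_inside_step_Suc)
  qed
  have F: "real (card (words (Suc n) False k j)) = count_outside (Suc n) k j"
  proof (cases k)
    case 0
    with Suc.prems show ?thesis using Suc.IH[of 0 0]
      by (simp add: card_words_False_0_0 count_outside_0)
  next
    case k: (Suc k')
    show ?thesis
    proof (cases j)
      case 0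
      then show ?thesis using Suc.IH[of 0 k] Suc.IH[of 0 k']
        by (simp add: k card_words_False_Suc_0 count_outside_step_0)
    next
      case (Suc i)
      \<comment> \<open>Here \<open>Suc i\<close> can be \<open>k' + 1\<close>, just beyond the
        range of the induction hypothesis. There the set is empty and the linear factor of
        \<open>count_inside\<close> is zero.\<close>
      have "real (card (words n True k' (Suc i))) = count_inside n k' (Suc i)"
      proof (cases "Suc i \<le> k'")
        case False
        then have "i = k'" using Suc k Suc.prems by simp
        then show ?thesis by (simp add: words_empty count_inside_def)
      qed (use Suc.IH in simp)
      then show ?thesis using Suc.prems Suc.IH[of i k] Suc.IH[of j k]
        by (simp add: k Suc card_words_False_Suc_Suc count_outside_step_Suc)
    qed
  qed
  from T F show ?case by simp
qed

section \<open>Balanced words: the diagonal values and their sum\<close>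

lemma count_outside_diag:
  assumes "n \<ge> 1"
  shows "count_outside n k k = 1 / real (2 * k + 1) * real ((n - k - 1) choose k) * real (n choose (2 * k))"
proof (cases k)
  case 0 then show ?thesis by (simp add: count_outside_def)
next
  case (Suc i)
  show ?thesis
  proof (cases "2 * k \<le> n")
    case True
    define M where "M = n - k - 1"
    have M: "n - k = Suc M" "n - k - 1 = M" "real n - real k = real (Suc M)"
      using True Suc by (auto simp: M_def)
    have 1: "real (Suc i) * real (M choose Suc i) = (real M - real i) * real (M choose i)"
      by (rule binomial_absorb_up)
    \<comment> \<open>With \<open>k = Suc i\<close>, the two sides differ by twice the absorption
      identity \<open>1\<close>. This collapse of the two products leaves the factor
      \<open>1 / (2 * k + 1)\<close>.\<close>
    have "real (2 * k + 1) * (real (M choose Suc i) + real (M choose i)) - (2 * real (Suc M) + 1) * real (M choose i)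
       = real (M choose k)"
      using 1 by (simp add: Suc algebra_simps)
    then have "real (M choose Suc i) + real (M choose i) - (2 * real (Suc M) + 1) / real (2 * k + 1) * real (M choose i)
       = real (M choose k) / real (2 * k + 1)"
      by (simp add: field_simps)
    moreover have "count_outside n k k = real (n choose (2 * k)) *
       (real (M choose Suc i) + real (M choose i) - (2 * real (Suc M) + 1) / real (2 * k + 1) * real (M choose i))"
      unfolding count_outside_def M by (simp add: Suc add.commute)
    ultimately show ?thesis unfolding M by (simp add: mult.commute)
  next
    case False
    then show ?thesis by (simp add: count_outside_def binomial_eq_0)
  qed
qed

text \<open>The words are split by the common value \<open>k\<close> of \<open>ups\<close> and
  \<open>closers\<close>. Beyond \<open>(n - 1) div 2\<close> one has \<open>n - k - 1 < k\<close>,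
  so the summands vanish.\<close>

lemma card_balanced_words:
  assumes "n \<ge> 1"
  shows "real (card {w. length w = n \<and> admissible w \<and> \<not> in_block w \<and> ups w = closers w}) =
    (\<Sum>k = 0..(n - 1) div 2.
       1 / real (2 * k + 1) * real ((n - k - 1) choose k) * real (n choose (2 * k)))"
    (is "real (card ?W) = (\<Sum>k = 0.._. ?f k)")
proof -
  have "?W = (\<Union>k\<in>{0..n}. words n False k k)"
    by (auto simp: words_def) (metis ups_le_length)
  then have "card ?W = (\<Sum>k = 0..n. card (words n False k k))"
    by (simp only:, intro card_UN_disjoint ballI finite_words) (auto simp: words_def)
  then have "real (card ?W) = (\<Sum>k = 0..n. ?f k)"
    using card_words count_outside_diag[OF assms] by simp
  also have "\<dots> = (\<Sum>k = 0..(n - 1) div 2. ?f k)"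
  proof (rule sum.mono_neutral_right)
    show "\<forall>k \<in> {0..n} - {0..(n - 1) div 2}. ?f k = 0"
    proof
      fix k assume "k \<in> {0..n} - {0..(n - 1) div 2}"
      then have "n - k - 1 < k" using assms by auto
      then show "?f k = 0" by simp
    qed
  qed auto
  finally show ?thesis .
qed

subsection \<open>Noncrossing matchings\<close>

text \<open>\<open>q d\<close> is the right end of the hook that starts at \<open>d\<close>.
  Equality in \<open>q d \<le> d'\<close> lets one hook end where the next starts; the strict
  \<open>q d' < q d\<close> rules out a common right end.\<close>

definition noncrossing :: "nat set \<Rightarrow> (nat \<Rightarrow> nat) \<Rightarrow> bool" where
  "noncrossing D q \<longleftrightarrow> (\<forall>d\<in>D. d < q d) \<and>
     (\<forall>d\<in>D. \<forall>d'\<in>D. d < d' \<longrightarrow> q d \<le> d' \<or> q d' < q d)"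

text \<open>
  The number of open hooks at \<open>v\<close>, after closing one at \<open>v\<close> and before opening one there.
\<close>

definition height :: "nat set \<Rightarrow> nat set \<Rightarrow> nat \<Rightarrow> int" where
  "height D C v = int (card (D \<inter> {..<v})) - int (card (C \<inter> {..v}))"

text \<open>The height at \<open>d\<close> does not yet count the hook opened at \<open>d\<close>,
  so that hook closes at the first return to this level.\<close>

definition partner :: "nat set \<Rightarrow> nat set \<Rightarrow> nat \<Rightarrow> nat" where
  "partner D C d = (LEAST j. d < j \<and> height D C j \<le> height D C d)"

lemma noncrossing_inj: "noncrossing D q \<Longrightarrow> inj_on q D"
  unfolding noncrossing_def inj_on_def by (metis leD less_irrefl linorder_neqE_nat)

text \<open>The hooks opened before \<open>v\<close> split into those that have ended by
  \<open>v\<close> and those that pass strictly over \<open>v\<close>. Distinct hooks have distinct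
  right ends, so the former are counted by their right ends.\<close>

lemma height_image:
  assumes "noncrossing D q"
  shows "height D (q ` D) v = int (card {d \<in> D. d < v \<and> v < q d})"
proof -
  have lt: "d < q d" if "d \<in> D" for d using assms that by (auto simp: noncrossing_def)
  have "q ` D \<inter> {..v} = q ` {d \<in> D. q d \<le> v}" by auto
  then have 1: "card (q ` D \<inter> {..v}) = card {d \<in> D. q d \<le> v}"
    using noncrossing_inj[OF assms] by (simp add: card_image inj_on_def)
  have "D \<inter> {..<v} = {d \<in> D. q d \<le> v} \<union> {d \<in> D. d < v \<and> v < q d}"
    using lt by force
  moreover have "finite {d \<in> D. q d \<le> v}"
    by (rule finite_subset[of _ "{..v}"]) (use lt in force)+
  moreover have "finite {d \<in> D. d < v \<and> v < q d}"
    by (rule finite_subset[of _ "{..v}"]) auto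
  ultimately have "card (D \<inter> {..<v}) = card {d \<in> D. q d \<le> v} + card {d \<in> D. d < v \<and> v < q d}"
    by (simp add: card_Un_disjoint disjoint_iff)
  with 1 show ?thesis by (simp add: height_def)
qed

text \<open>A hook over \<open>q d\<close> must start before \<open>d\<close>, hence passes over
  \<open>d\<close> too, so the level of \<open>d\<close> is reached again at \<open>q d\<close>. At
  \<open>v\<close> strictly between, all hooks over \<open>d\<close> are still open and the hook of
  \<open>d\<close> is added, so the height is larger. Thus the set of right ends determines the
  matching.\<close>

lemma noncrossing_partner:
  assumes "noncrossing D q" "d \<in> D"
  shows "partner D (q ` D) d = q d"
proof -
  note h = height_image[OF assms(1)]
  let ?over = "\<lambda>v. {d \<in> D. d < v \<and> v < q d}"
  have lt: "e < q e" if "e \<in> D" for e using assms that by (auto simp: noncrossing_def)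
  have nc: "q a \<le> b \<or> q b < q a" if "a \<in> D" "b \<in> D" "a < b" for a b
    using assms that by (auto simp: noncrossing_def)
  have fin: "finite (?over v)" for v by (rule finite_subset[of _ "{..v}"]) auto
  show ?thesis unfolding partner_def
  proof (rule Least_equality)
    have "?over (q d) \<subseteq> ?over d"
    proof
      fix e assume e: "e \<in> ?over (q d)"
      then have "e < d" using nc[of d e] assms(2) by (cases e d rule: linorder_cases) auto
      then show "e \<in> ?over d" using e lt[OF assms(2)] by auto
    qed
    then show "d < q d \<and> height D (q ` D) (q d) \<le> height D (q ` D) d"
      unfolding h using lt assms(2) by (auto intro: card_mono fin)
  next
    fix v assume v: "d < v \<and> height D (q ` D) v \<le> height D (q ` D) d"
    show "q d \<le> v"
    proof (rule ccontr)
      assume "\<not> q d \<le> v"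
      then have "insert d (?over d) \<subseteq> ?over v"
        using v nc assms(2) by fastforce
      then have "card (insert d (?over d)) \<le> card (?over v)" by (intro card_mono fin)
      then show False using v unfolding h by (simp add: fin)
    qed
  qed
qed

lemma height_Suc:
  "height D C (Suc v) =
     height D C v + (if v \<in> D then 1 else 0) - (if Suc v \<in> C then 1 else 0)"
proof -
  have "D \<inter> {..<Suc v} = (if v \<in> D then insert v (D \<inter> {..<v}) else D \<inter> {..<v})"
    by (auto simp: less_Suc_eq)
  moreover have "C \<inter> {..Suc v} = (if Suc v \<in> C then insert (Suc v) (C \<inter> {..v}) else C \<inter> {..v})"
    by (auto simp: le_Suc_eq)
  ultimately show ?thesis by (auto simp: height_def)
qed

text \<open>The height falls by at most one per step, so the first return meets the level of
  \<open>d\<close> exactly and does so at an element of \<open>C\<close>. Cardinality then makes the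
  injection of \<open>D\<close> into \<open>C\<close> onto.\<close>

lemma partner_properties:
  assumes D: "D \<subseteq> {1..<n}" and C: "C \<subseteq> {1..n}" "card C = card D"
    and h: "\<And>v. v \<le> n \<Longrightarrow> height D C v \<ge> 0" and disj: "C \<inter> Suc ` D = {}"
  shows "noncrossing D (partner D C)" "partner D C ` D = C"
proof -
  let ?H = "height D C" and ?q = "partner D C"
  have "D \<inter> {..<n} = D" "C \<inter> {..n} = C" using D C by auto
  then have n0: "?H n = 0" using C by (simp add: height_def)
  have q: "d < ?q d \<and> ?H (?q d) \<le> ?H d \<and> ?q d \<le> n" if "d \<in> D" for d
  proof -
    \<comment> \<open>The height is 0 at \<open>n\<close>, so \<open>n\<close> itself is a candidate
      for the least return.\<close>
    have "d < n \<and> ?H n \<le> ?H d" using that D h n0 by auto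
    then show ?thesis unfolding partner_def
      by (metis (mono_tags, lifting) LeastI Least_le)
  qed
  have above: "?H v > ?H d" if "d < v" "v < ?q d" for d v
    using not_less_Least[of v "\<lambda>j. d < j \<and> ?H j \<le> ?H d"] that unfolding partner_def by force
  have hit: "?q d \<in> C \<and> ?H (?q d) = ?H d" if d: "d \<in> D" for d
  proof -
    obtain v where v: "?q d = Suc v" "d \<le> v" using q[OF d] by (metis less_eq_Suc_le Suc_le_D Suc_le_mono)
    show ?thesis
    proof (cases "v = d")
      case True
      \<comment> \<open>An immediate return is impossible: by \<open>disj\<close> nothing closes at
        \<open>Suc d\<close>, while the hook opened at \<open>d\<close> raises the height.\<close>
      then have "?H (Suc d) \<le> ?H d" "Suc d \<notin> C" using q[OF d] v disj d by auto
      then show ?thesis using d by (simp add: height_Suc)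
    next
      case False
      then have "?H v > ?H d" using above[of d v] v by auto
      then show ?thesis using q[OF d] v height_Suc[of D C v] by (auto split: if_splits)
    qed
  qed
  show nc: "noncrossing D ?q"
    unfolding noncrossing_def
  proof (intro conjI ballI impI)
    fix d assume "d \<in> D" then show "d < ?q d" using q by auto
  next
    fix d d' assume d: "d \<in> D" "d' \<in> D" "d < d'"
    show "?q d \<le> d' \<or> ?q d' < ?q d"
    proof (rule ccontr)
      assume "\<not> ?thesis"
      then have a: "d' < ?q d" "?q d \<le> ?q d'" by auto
      \<comment> \<open>A crossing would put \<open>?q d\<close> strictly inside the hook of
        \<open>d'\<close>, where the height exceeds that at \<open>d'\<close> and hence that at
        \<open>d\<close>. But the height at \<open>?q d\<close> equals that at \<open>d\<close>. A
        common right end would equate the two levels.\<close>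
      have lt: "?H d < ?H d'" using above[of d d'] d a by auto
      have "?q d \<noteq> ?q d'" using lt hit[of d] hit[of d'] d by auto
      then have "?H (?q d) > ?H d'" using above[of d' "?q d"] a by auto
      then show False using lt hit[of d] d by auto
    qed
  qed
  have "finite C" using C finite_subset by blast
  moreover have "?q ` D \<subseteq> C" using hit by auto
  moreover have "card (?q ` D) = card C" using noncrossing_inj[OF nc] C by (simp add: card_image)
  ultimately show "?q ` D = C" by (rule card_subset_eq)
qed

section \<open>Words read off from two predicates on positions\<close>

fun word :: "(nat \<Rightarrow> bool) \<Rightarrow> (nat \<Rightarrow> bool) \<Rightarrow> nat \<Rightarrow> (bool \<times> bool) list" where
  "word b c 0 = []"
| "word b c (Suc i) = (b (Suc i), c (Suc i)) # word b c i"

lemma length_word [simp]: "length (word b c n) = n"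
  by (induction n) auto

lemma word_eq_iff:
  "word b c n = word b' c' n \<longleftrightarrow> (\<forall>i\<in>{1..n}. b i = b' i \<and> c i = c' i)"
  by (induction n) (simp_all add: atLeastAtMostSuc_conv conj_ac)

lemma word_exists: "length w = n \<Longrightarrow> \<exists>b c. w = word b c n"
proof (induction n arbitrary: w)
  case (Suc n)
  then obtain x v where w: "w = x # v" "length v = n" by (auto simp: length_Suc_conv)
  with Suc.IH obtain b c where "v = word b c n" by blast
  moreover have "word b c n = word (b(Suc n := fst x)) (c(Suc n := snd x)) n"
    unfolding word_eq_iff by auto
  ultimately have "w = word (b(Suc n := fst x)) (c(Suc n := snd x)) (Suc n)"
    unfolding w word.simps by simp
  then show ?case by blast
qed simp

lemma in_block_word: "in_block (word b c n) \<longleftrightarrow> 1 \<le> n \<and> b n"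
  by (cases n) auto

text \<open>\<open>D\<close> collects the positions at which \<open>b\<close> switches from true to
  false; for the encoded permutation these are the descents. The one at \<open>i\<close> is counted
  at letter \<open>i + 1\<close>, hence the strict bound on the right.\<close>

lemma ups_word:
  assumes "\<And>i. i < n \<Longrightarrow> i \<in> D \<longleftrightarrow> 1 \<le> i \<and> b i \<and> \<not> b (Suc i)"
  shows "ups (word b c n) = card (D \<inter> {..<n})"
  using assms
proof (induction n)
  case (Suc n)
  have "D \<inter> {..<Suc n} = (if n \<in> D then insert n (D \<inter> {..<n}) else D \<inter> {..<n})"
    by (auto simp: less_Suc_eq)
  then have "card (D \<inter> {..<Suc n}) = card (D \<inter> {..<n}) + (if n \<in> D then 1 else 0)"
    by simp
  moreover have "ups (word b c n) = card (D \<inter> {..<n})"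
    by (rule Suc.IH) (rule Suc.prems, simp)
  moreover have "n \<in> D \<longleftrightarrow> in_block (word b c n) \<and> \<not> b (Suc n)"
    using Suc.prems[of n] by (simp add: in_block_word)
  ultimately show ?case by simp
qed simp

lemma closers_word:
  assumes "\<And>i. 1 \<le> i \<Longrightarrow> i \<le> n \<Longrightarrow> i \<in> C \<longleftrightarrow> c i" "0 \<notin> C"
  shows "closers (word b c n) = card (C \<inter> {..n})"
  using assms
proof (induction n)
  case (Suc n)
  have "C \<inter> {..Suc n} = (if Suc n \<in> C then insert (Suc n) (C \<inter> {..n}) else C \<inter> {..n})"
    by (auto simp: le_Suc_eq)
  then have "card (C \<inter> {..Suc n}) = card (C \<inter> {..n}) + (if Suc n \<in> C then 1 else 0)"
    by simp
  moreover have "closers (word b c n) = card (C \<inter> {..n})"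
    using Suc.prems(2) by (rule Suc.IH[rotated]) (rule Suc.prems(1), simp_all)
  ultimately show ?case using Suc.prems(1)[of "Suc n"] by simp
qed simp

text \<open>If \<open>n\<close> is not in \<open>D\<close>, closing at \<open>Suc n\<close> lowers
  the height by one, so a positive height before closing is the same as a nonnegative one after it.
  Without closing, the height cannot fall.\<close>

lemma admissible_word:
  assumes "\<And>i. i < n \<Longrightarrow> i \<in> D \<longleftrightarrow> 1 \<le> i \<and> b i \<and> \<not> b (Suc i)"
    and "\<And>i. 1 \<le> i \<Longrightarrow> i \<le> n \<Longrightarrow> i \<in> C \<longleftrightarrow> c i" "0 \<notin> C"
  shows "admissible (word b c n) \<longleftrightarrow>
    (\<forall>v\<le>n. height D C v \<ge> 0 \<and> (v \<in> C \<longrightarrow> v \<notin> Suc ` D))"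
  using assms
proof (induction n)
  case 0
  then show ?case by (simp add: height_def)
next
  case (Suc n)
  have D: "\<And>i. i < n \<Longrightarrow> i \<in> D \<longleftrightarrow> 1 \<le> i \<and> b i \<and> \<not> b (Suc i)"
    and C: "\<And>i. 1 \<le> i \<Longrightarrow> i \<le> n \<Longrightarrow> i \<in> C \<longleftrightarrow> c i"
    using Suc.prems by auto
  have h: "int (ups (word b c n)) - int (closers (word b c n)) = height D C n"
    using ups_word[OF D] closers_word[OF C Suc.prems(3)] by (simp add: height_def)
  have IH: "admissible (word b c n) \<longleftrightarrow> (\<forall>v\<le>n. height D C v \<ge> 0 \<and> (v \<in> C \<longrightarrow> v \<notin> Suc ` D))"
    by (rule Suc.IH[OF D C Suc.prems(3)])
  have n: "n \<in> D \<longleftrightarrow> in_block (word b c n) \<and> \<not> b (Suc n)"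
    using Suc.prems(1)[of n] by (simp add: in_block_word)
  have c: "Suc n \<in> C \<longleftrightarrow> c (Suc n)" using Suc.prems(2)[of "Suc n"] by simp
  have lt: "closers (word b c n) < ups (word b c n) \<longleftrightarrow> height D C n > 0"
    using h by linarith
  have "admissible (word b c (Suc n)) \<longleftrightarrow> admissible (word b c n) \<and>
    (Suc n \<in> C \<longrightarrow> height D C n > 0 \<and> n \<notin> D)"
    unfolding word.simps admissible.simps lt n c by blast
  also have "\<dots> \<longleftrightarrow> admissible (word b c n) \<and> height D C (Suc n) \<ge> 0 \<and> (Suc n \<in> C \<longrightarrow> n \<notin> D)"
  proof -
    have "height D C n \<ge> 0" if "admissible (word b c n)" using that IH by blast
    then show ?thesis using height_Suc[of D C n] by (auto split: if_splits)
  qed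
  also have "\<dots> \<longleftrightarrow> (\<forall>v\<le>Suc n. height D C v \<ge> 0 \<and> (v \<in> C \<longrightarrow> v \<notin> Suc ` D))"
  proof -
    have "Suc n \<in> Suc ` D \<longleftrightarrow> n \<in> D" by blast
    then show ?thesis unfolding IH le_Suc_eq by blast
  qed
  finally show ?case .
qed

subsection \<open>Permutations avoiding 312 and 321\<close>

lemma permutation_entry:
  assumes "p \<in> permutations_of_set {1..n}"
  shows "length p = n" "bij_betw (entry p) {1..n} {1..n}"
proof -
  have p: "set p = {1..n}" "distinct p" using assms by (auto simp: permutations_of_set_def)
  then show l: "length p = n" using distinct_card[of p] by simp
  have "bij_betw (nth p) {..<n} {1..n}" using p l by (intro bij_betw_nth) auto
  moreover have "bij_betw (\<lambda>i. i - 1) {1..n} {..<n}"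
    by (rule bij_betw_byWitness[of _ Suc]) auto
  ultimately have "bij_betw (nth p \<circ> (\<lambda>i. i - 1)) {1..n} {1..n}"
    using bij_betw_trans by blast
  moreover have "nth p \<circ> (\<lambda>i. i - 1) = entry p" by (auto simp: entry_def)
  ultimately show "bij_betw (entry p) {1..n} {1..n}" by simp
qed

section \<open>Pattern containment in terms of positions\<close>

lemma subseq_Cons_drop:
  "subseq (x # xs) (drop m p) \<longleftrightarrow> (\<exists>i\<ge>m. i < length p \<and> p ! i = x \<and> subseq xs (drop (Suc i) p))"
proof
  assume "subseq (x # xs) (drop m p)"
  then obtain us vs where *: "drop m p = us @ x # vs" "subseq xs vs"
    by (auto dest!: list_emb_ConsD)
  define i where "i = m + length us"
  have l: "length (drop m p) = length us + Suc (length vs)" using * by simp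
  then have i: "i < length p" "m \<le> i" by (auto simp: i_def)
  have "p ! i = drop m p ! length us" using i by (simp add: i_def)
  then have "p ! i = x" using * by simp
  moreover have "drop (Suc i) p = drop (Suc (length us)) (drop m p)" by (simp add: i_def add.commute)
  then have "drop (Suc i) p = vs" using * by simp
  ultimately show "\<exists>i\<ge>m. i < length p \<and> p ! i = x \<and> subseq xs (drop (Suc i) p)"
    using i * by auto
next
  assume "\<exists>i\<ge>m. i < length p \<and> p ! i = x \<and> subseq xs (drop (Suc i) p)"
  then obtain i where i: "i \<ge> m" "i < length p" "p ! i = x" "subseq xs (drop (Suc i) p)" by blast
  have "drop m p = take (i - m) (drop m p) @ drop i p"
    using i by (metis append_take_drop_id drop_drop le_add_diff_inverse2)
  also have "drop i p = x # drop (Suc i) p" using i by (metis Cons_nth_drop_Suc)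
  finally have "drop m p = take (i - m) (drop m p) @ x # drop (Suc i) p" .
  then show "subseq (x # xs) (drop m p)"
    by (metis i(4) list_emb_append2 subseq_Cons2)
qed

lemma contains_pattern_3:
  "contains_pattern p [x, y, z] \<longleftrightarrow>
     (\<exists>i j k. 1 \<le> i \<and> i < j \<and> j < k \<and> k \<le> length p \<and>
        same_relative_order [entry p i, entry p j, entry p k] [x, y, z])" (is "?L \<longleftrightarrow> ?R")
proof
  assume ?L
  then obtain xs where xs: "subseq xs p" "same_relative_order xs [x, y, z]"
    by (auto simp: contains_pattern_def)
  then have "length xs = Suc (Suc (Suc 0))" by (simp add: same_relative_order_def)
  then obtain a b c where abc: "xs = [a, b, c]" by (auto simp: length_Suc_conv)
  then have "subseq [a, b, c] (drop 0 p)" using xs by simp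
  then obtain i j k where "i < j" "j < k" "k < length p" "p ! i = a" "p ! j = b" "p ! k = c"
    unfolding subseq_Cons_drop by (metis Suc_le_lessD)
  then show ?R using xs(2) abc
    by (intro exI[of _ "Suc i"] exI[of _ "Suc j"] exI[of _ "Suc k"]) (auto simp: entry_def)
next
  assume ?R
  then obtain i j k where *: "1 \<le> i" "i < j" "j < k" "k \<le> length p"
     "same_relative_order [entry p i, entry p j, entry p k] [x, y, z]" by blast
  have "subseq [entry p i, entry p j, entry p k] (drop 0 p)"
    unfolding subseq_Cons_drop
    by (intro exI[of _ "i - 1"] exI[of _ "j - 1"] exI[of _ "k - 1"] conjI) (use * in \<open>auto simp: entry_def\<close>)
  then show ?L using * by (auto simp: contains_pattern_def)
qed

lemma same_relative_order_312: "same_relative_order [a, b, c] [3, 1, 2] \<longleftrightarrow> b < c \<and> c < a"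
  by (auto simp: same_relative_order_def All_less_Suc)

lemma same_relative_order_321: "same_relative_order [a, b, c] [3, 2, 1] \<longleftrightarrow> c < b \<and> b < a"
  by (auto simp: same_relative_order_def All_less_Suc)

text \<open>The name refers to matrices that vanish beyond the first off-diagonal on one side, as
  the permutation matrix of \<open>f\<close> does.\<close>

definition hessenberg :: "nat \<Rightarrow> (nat \<Rightarrow> nat) \<Rightarrow> bool" where
  "hessenberg n f \<longleftrightarrow> bij_betw f {1..n} {1..n} \<and> (\<forall>i\<in>{1..n}. f i \<le> Suc i)"

text \<open>Both directions count. If entries are bounded as required, two smaller entries after
  \<open>i\<close> would give \<open>i + 2\<close> positions with values at most
  \<open>i + 1\<close>. If \<open>f i \<ge> i + 2\<close>, at least \<open>i + 1\<close> values are
  smaller and at most \<open>i - 1\<close> of them occur before \<open>i\<close>, so two occur after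
  it.\<close>

lemma hessenberg_iff:
  assumes bij: "bij_betw f {1..n} {1..n}"
  shows "hessenberg n f \<longleftrightarrow>
    \<not> (\<exists>i j k. 1 \<le> i \<and> i < j \<and> j < k \<and> k \<le> n \<and> f j < f i \<and> f k < f i)"
proof
  assume h: "hessenberg n f"
  show "\<not> (\<exists>i j k. 1 \<le> i \<and> i < j \<and> j < k \<and> k \<le> n \<and> f j < f i \<and> f k < f i)"
  proof
    assume "\<exists>i j k. 1 \<le> i \<and> i < j \<and> j < k \<and> k \<le> n \<and> f j < f i \<and> f k < f i"
    then obtain i j k where *: "1 \<le> i" "i < j" "j < k" "k \<le> n" "f j < f i" "f k < f i" by blast
    have le: "f x \<le> Suc x" "1 \<le> f x" if "x \<in> {1..n}" for x
      using h that bij_betwE[OF bij] by (auto simp: hessenberg_def)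
    have "f ` ({1..i} \<union> {j, k}) \<subseteq> {1..Suc i}"
    proof
      fix y assume "y \<in> f ` ({1..i} \<union> {j, k})"
      then show "y \<in> {1..Suc i}" using * le[of i] le[of j] le[of k] le by force
    qed
    moreover have "inj_on f ({1..i} \<union> {j, k})"
      by (rule inj_on_subset[OF bij_betw_imp_inj_on[OF bij]]) (use * in auto)
    ultimately have "card ({1..i} \<union> {j, k}) \<le> card {1..Suc i}" by (metis card_inj_on_le finite_atLeastAtMost)
    moreover have "card ({1..i} \<union> {j, k}) = i + 2"
      using * by (subst card_Un_disjoint) auto
    ultimately show False by simp
  qed
next
  assume no: "\<not> (\<exists>i j k. 1 \<le> i \<and> i < j \<and> j < k \<and> k \<le> n \<and> f j < f i \<and> f k < f i)"
  show "hessenberg n f"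
    unfolding hessenberg_def
  proof (intro conjI ballI bij)
    fix i assume i: "i \<in> {1..n}"
    show "f i \<le> Suc i"
    proof (rule ccontr)
      assume a: "\<not> f i \<le> Suc i"
      define K where "K = {x \<in> {1..n}. f x < f i}"
      have inj: "inj_on f {1..n}" and im: "f ` {1..n} = {1..n}" using bij by (auto simp: bij_betw_def)
      have "f ` K = {1..<f i}"
      proof
        show "f ` K \<subseteq> {1..<f i}"
        proof
          fix y assume "y \<in> f ` K"
          then obtain x where "y = f x" "x \<in> {1..n}" "f x < f i" by (auto simp: K_def)
          then show "y \<in> {1..<f i}" using bij_betwE[OF bij] by auto
        qed
        show "{1..<f i} \<subseteq> f ` K"
        proof
          fix y assume y: "y \<in> {1..<f i}"
          have "f i \<le> n" using i bij_betwE[OF bij] by auto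
          then have "y \<in> f ` {1..n}" unfolding im using y by auto
          then show "y \<in> f ` K" using y by (auto simp: K_def)
        qed
      qed
      moreover have "inj_on f K" using inj by (rule inj_on_subset) (auto simp: K_def)
      ultimately have cK: "card K = f i - 1" by (metis card_image card_atLeastLessThan)
      have "K \<subseteq> (K \<inter> {1..<i}) \<union> (K \<inter> {i<..n})"
      proof
        fix x assume x: "x \<in> K"
        then have "x \<noteq> i" "x \<in> {1..n}" by (auto simp: K_def)
        then show "x \<in> (K \<inter> {1..<i}) \<union> (K \<inter> {i<..n})" using x by (cases "x < i") auto
      qed
      then have "card K \<le> card ((K \<inter> {1..<i}) \<union> (K \<inter> {i<..n}))" by (intro card_mono) auto
      then have "card K \<le> card (K \<inter> {1..<i}) + card (K \<inter> {i<..n})"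
        using card_Un_le order_trans by blast
      moreover have "card (K \<inter> {1..<i}) \<le> card {1..<i}" by (intro card_mono) auto
      ultimately have "card (K \<inter> {i<..n}) \<ge> 2" using cK a i by auto
      then obtain T where "T \<subseteq> K \<inter> {i<..n}" "card T = 2"
        by (metis obtain_subset_with_card_n)
      then obtain j k where "j \<in> K \<inter> {i<..n}" "k \<in> K \<inter> {i<..n}" "j \<noteq> k"
        by (auto simp: card_2_iff)
      then have jk: "i < j" "i < k" "j \<le> n" "k \<le> n" "f j < f i" "f k < f i" "j < k \<or> k < j"
        by (auto simp: K_def)
      moreover have "1 \<le> i" using i by simp
      ultimately show False using no by blast
    qed
  qed
qed

text \<open>The two patterns differ only in the order of their last two entries. Avoiding both
  therefore means that no entry has two smaller ones after it.\<close>

lemma Av_312_321: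
  "Av n {[3, 1, 2], [3, 2, 1]} = {p \<in> permutations_of_set {1..n}. hessenberg n (entry p)}"
proof -
  have "(\<forall>s\<in>{[3, 1, 2], [3, 2, 1]}. \<not> contains_pattern p s) \<longleftrightarrow> hessenberg n (entry p)"
    if p: "p \<in> permutations_of_set {1..n}" for p
  proof -
    let ?f = "entry p"
    note pe = permutation_entry[OF p]
    have neq: "?f j \<noteq> ?f k" if "1 \<le> j" "j < k" "k \<le> n" for j k
      using inj_onD[OF bij_betw_imp_inj_on[OF pe(2)], of j k] that by auto
    have "contains_pattern p [3, 1, 2] \<or> contains_pattern p [3, 2, 1] \<longleftrightarrow>
      (\<exists>i j k. 1 \<le> i \<and> i < j \<and> j < k \<and> k \<le> n \<and> ?f j < ?f i \<and> ?f k < ?f i)" (is "?L \<longleftrightarrow> ?R")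
      unfolding contains_pattern_3 same_relative_order_312 same_relative_order_321 pe(1)
    proof
      assume ?R
      then obtain i j k where *: "1 \<le> i" "i < j" "j < k" "k \<le> n" "?f j < ?f i" "?f k < ?f i"
        by blast
      then have "?f j < ?f k \<or> ?f k < ?f j" using neq[of j k] by linarith
      with * show "(\<exists>i j k. 1 \<le> i \<and> i < j \<and> j < k \<and> k \<le> n \<and> ?f j < ?f k \<and> ?f k < ?f i) \<or>
        (\<exists>i j k. 1 \<le> i \<and> i < j \<and> j < k \<and> k \<le> n \<and> ?f k < ?f j \<and> ?f j < ?f i)"
        by blast
    qed (blast intro: less_trans)
    then show ?thesis
      unfolding hessenberg_iff[OF pe(2)] by blast
  qed
  then show ?thesis by (auto simp: Av_def)
qed

section \<open>Descents, and reconstruction from the positions with an entry above the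
  position\<close>

lemma hessenbergD:
  assumes "hessenberg n f"
  shows "inj_on f {1..n}" "f ` {1..n} = {1..n}"
    and "i \<in> {1..n} \<Longrightarrow> f i \<le> Suc i" "i \<in> {1..n} \<Longrightarrow> 1 \<le> f i" "i \<in> {1..n} \<Longrightarrow> f i \<le> n"
proof -
  have bij: "bij_betw f {1..n} {1..n}" using assms by (simp add: hessenberg_def)
  then show "inj_on f {1..n}" "f ` {1..n} = {1..n}" by (simp_all add: bij_betw_def)
  show "i \<in> {1..n} \<Longrightarrow> f i \<le> Suc i" using assms by (simp add: hessenberg_def)
  show "i \<in> {1..n} \<Longrightarrow> 1 \<le> f i" "i \<in> {1..n} \<Longrightarrow> f i \<le> n" using bij_betwE[OF bij] by auto
qed

text \<open>The value \<open>j\<close> cannot sit before position \<open>j - 1\<close>, nor at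
  \<open>j\<close>. If it sat after \<open>j\<close>, the first \<open>j\<close> positions would
  have only values below \<open>j\<close>, against injectivity.\<close>

lemma hessenberg_small_entry:
  assumes h: "hessenberg n f" and j: "j \<in> {1..n}" "f j < j"
  shows "1 < j \<and> f (j - 1) = j"
proof -
  note inj = hessenbergD(1)[OF h] and le = hessenbergD(3)[OF h] and pos = hessenbergD(4)[OF h]
  obtain i where i: "i \<in> {1..n}" "f i = j"
    using j(1) hessenbergD(2)[OF h] by (metis imageE)
  have "j \<le> Suc i" using le[OF i(1)] i(2) by simp
  moreover have "i \<noteq> j" using i(2) j(2) by auto
  moreover have "\<not> j < i"
  proof
    assume "j < i"
    have "f ` {1..j} \<subseteq> {1..<j}"
    proof
      fix y assume "y \<in> f ` {1..j}"
      then obtain x where x: "x \<in> {1..j}" "y = f x" by blast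
      then have xn: "x \<in> {1..n}" using j(1) by simp
      have "f x \<noteq> j"
      proof
        assume "f x = j"
        then have "x = i" using inj_onD[OF inj _ xn i(1)] i(2) by simp
        then show False using x(1) \<open>j < i\<close> by simp
      qed
      moreover have "f x \<le> j"
      proof (cases "x = j")
        case True
        then show ?thesis using j(2) by simp
      next
        case False
        then show ?thesis using le[OF xn] x(1) by simp
      qed
      ultimately show "y \<in> {1..<j}" using pos[OF xn] x(2) by simp
    qed
    moreover have "inj_on f {1..j}" by (rule inj_on_subset[OF inj]) (use j(1) in auto)
    ultimately have "card {1..j} \<le> card {1..<j}" by (metis card_inj_on_le finite_atLeastLessThan)
    then have "j \<le> j - 1" by simp
    then show False using j(1) by (cases j) simp_all
  qed
  ultimately have "j = Suc i" by simp
  then show ?thesis using i by simp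
qed

text \<open>In a block \<open>2 3 ... m 1\<close> the only descent is just before the last position.
  A descent at \<open>d\<close> forces an entry below its position at \<open>Suc d\<close>, and
  \<open>hessenberg_small_entry\<close> then gives the value at \<open>d\<close>.\<close>

lemma hessenberg_descent:
  assumes "hessenberg n f" "1 \<le> d" "d < n"
  shows "f (Suc d) < f d \<longleftrightarrow> f d = Suc d \<and> f (Suc d) \<noteq> Suc (Suc d)"
proof
  assume a: "f (Suc d) < f d"
  have "f d \<le> Suc d" using hessenbergD(3)[OF assms(1), of d] assms(2,3) by simp
  then have "f (Suc d) < Suc d" using a by simp
  then show "f d = Suc d \<and> f (Suc d) \<noteq> Suc (Suc d)"
    using hessenberg_small_entry[OF assms(1), of "Suc d"] assms by auto
next
  assume a: "f d = Suc d \<and> f (Suc d) \<noteq> Suc (Suc d)"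
  have "f (Suc d) \<noteq> f d"
    using inj_onD[OF hessenbergD(1)[OF assms(1)], of "Suc d" d] assms(2,3) by auto
  moreover have "f (Suc d) \<le> Suc (Suc d)"
    using hessenbergD(3)[OF assms(1), of "Suc d"] assms(2,3) by simp
  ultimately show "f (Suc d) < f d" using a by auto
qed

text \<open>If the entry at \<open>i\<close> is not \<open>Suc i\<close>, it is at most
  \<open>i\<close>. The \<open>i - 1\<close> earlier entries also lie in \<open>{1..i}\<close>, so
  exactly one value is left for it.\<close>

lemma hessenberg_unique:
  assumes f: "hessenberg n f" and g: "hessenberg n g"
    and eq: "\<And>i. i \<in> {1..n} \<Longrightarrow> f i = Suc i \<longleftrightarrow> g i = Suc i"
  shows "i \<in> {1..n} \<Longrightarrow> f i = g i"
proof (induction i rule: less_induct)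
  case (less i)
  have sub: "x \<in> {1..n}" "x \<noteq> i" if "x \<in> {1..<i}" for x using that less.prems by auto
  have prev: "f ` {1..<i} = g ` {1..<i}"
  proof (rule image_cong[OF refl])
    fix x assume "x \<in> {1..<i}"
    then show "f x = g x" using less.IH[of x] sub by simp
  qed
  show ?case
  proof (cases "f i = Suc i")
    case True
    then show ?thesis using eq[OF less.prems] by simp
  next
    case False
    then have le: "f i \<le> i" "g i \<le> i"
      using eq[OF less.prems] hessenbergD(3)[OF f less.prems] hessenbergD(3)[OF g less.prems] by auto
    have ni: "h i \<notin> h ` {1..<i}" if "hessenberg n h" for h
      using inj_onD[OF hessenbergD(1)[OF that], of i] sub less.prems by blast
    have fi: "f i \<notin> f ` {1..<i}" and gi: "g i \<notin> f ` {1..<i}"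
      using ni[OF f] ni[OF g] unfolding prev by blast+
    have c: "card (f ` {1..<i}) = i - 1"
    proof -
      have "inj_on f {1..<i}" by (rule inj_on_subset[OF hessenbergD(1)[OF f]]) (use sub in blast)
      then show ?thesis by (simp add: card_image)
    qed
    have "f x \<in> {1..i}" if "x \<in> {1..<i}" for x
      using hessenbergD(3,4)[OF f sub(1)[OF that]] that by auto
    then have "insert (f i) (insert (g i) (f ` {1..<i})) \<subseteq> {1..i}"
      using le hessenbergD(4)[OF f less.prems] hessenbergD(4)[OF g less.prems] by auto
    then have "card (insert (f i) (insert (g i) (f ` {1..<i}))) \<le> card {1..i}"
      by (intro card_mono) auto
    then show ?thesis using fi gi c less.prems by (auto simp: card_insert_if split: if_splits)
  qed
qed

text \<open>Placing the missing value \<open>m\<close> closes a block.\<close>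

lemma hessenberg_prefix_exists:
  "\<exists>xs m. length xs = i \<and> distinct xs \<and> m \<in> {1..Suc i} \<and> set xs = {1..Suc i} - {m} \<and>
     (1 \<le> i \<longrightarrow> \<not> b i \<longrightarrow> m = Suc i) \<and>
     (\<forall>j\<in>{1..i}. entry xs j \<le> Suc j \<and> (entry xs j = Suc j \<longleftrightarrow> b j))"
proof (induction i)
  case 0
  show ?case by (intro exI[of _ "[]"] exI[of _ 1]) simp
next
  case (Suc i)
  then obtain xs m where xs: "length xs = i" "distinct xs" "m \<in> {1..Suc i}" "set xs = {1..Suc i} - {m}"
    "\<forall>j\<in>{1..i}. entry xs j \<le> Suc j \<and> (entry xs j = Suc j \<longleftrightarrow> b j)" by blast
  have e: "\<forall>j\<in>{1..Suc i}. entry (xs @ [x]) j \<le> Suc j \<and> (entry (xs @ [x]) j = Suc j \<longleftrightarrow> b j)"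
    if "x \<le> Suc (Suc i)" "x = Suc (Suc i) \<longleftrightarrow> b (Suc i)" for x
  proof
    fix j assume j: "j \<in> {1..Suc i}"
    show "entry (xs @ [x]) j \<le> Suc j \<and> (entry (xs @ [x]) j = Suc j \<longleftrightarrow> b j)"
    proof (cases "j = Suc i")
      case True
      then have "entry (xs @ [x]) j = x" using xs(1) by (simp add: entry_def nth_append)
      then show ?thesis using that True by simp
    next
      case False
      then have "j \<in> {1..i}" using j by simp
      moreover from this have "entry (xs @ [x]) j = entry xs j"
        using xs(1) by (auto simp: entry_def nth_append)
      ultimately show ?thesis using xs(5) by simp
    qed
  qed
  show ?case
  proof (cases "b (Suc i)")
    case True
    show ?thesis
    proof (intro exI conjI)
      show "length (xs @ [Suc (Suc i)]) = Suc i" using xs(1) by simp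
      show "distinct (xs @ [Suc (Suc i)])" using xs(2,4) by auto
      show "m \<in> {1..Suc (Suc i)}" using xs(3) by simp
      show "set (xs @ [Suc (Suc i)]) = {1..Suc (Suc i)} - {m}"
        using xs(3) unfolding set_append xs(4) by auto
      show "1 \<le> Suc i \<longrightarrow> \<not> b (Suc i) \<longrightarrow> m = Suc (Suc i)" using True by blast
    qed (rule e, use True in simp_all)
  next
    case False
    show ?thesis
    proof (intro exI conjI)
      show "length (xs @ [m]) = Suc i" using xs(1) by simp
      show "distinct (xs @ [m])" using xs(2,4) by auto
      show "Suc (Suc i) \<in> {1..Suc (Suc i)}" by simp
      show "set (xs @ [m]) = {1..Suc (Suc i)} - {Suc (Suc i)}"
        using xs(3) unfolding set_append xs(4) by auto
      show "1 \<le> Suc i \<longrightarrow> \<not> b (Suc i) \<longrightarrow> Suc (Suc i) = Suc (Suc i)" by blast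
    qed (rule e, use False xs(3) in auto)
  qed
qed

text \<open>A prefix of length \<open>n\<close> misses one value of \<open>{1..Suc n}\<close>. As
  \<open>b n\<close> fails, the missing value is \<open>Suc n\<close>, and the prefix is a
  permutation of \<open>{1..n}\<close>.\<close>

lemma hessenberg_exists:
  assumes "n \<ge> 1" "\<not> b n"
  obtains p where "p \<in> permutations_of_set {1..n}" "hessenberg n (entry p)"
    "\<And>i. i \<in> {1..n} \<Longrightarrow> entry p i = Suc i \<longleftrightarrow> b i"
proof -
  obtain p m where *: "distinct p" "set p = {1..Suc n} - {m}" "1 \<le> n \<longrightarrow> \<not> b n \<longrightarrow> m = Suc n"
    and p: "\<forall>j\<in>{1..n}. entry p j \<le> Suc j \<and> (entry p j = Suc j \<longleftrightarrow> b j)"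
    using hessenberg_prefix_exists[of n b] by blast
  have "{1..Suc n} - {Suc n} = {1..n}" by auto
  with * assms have perm: "p \<in> permutations_of_set {1..n}" by (simp add: permutations_of_set_def)
  show ?thesis
  proof (rule that[OF perm])
    show "hessenberg n (entry p)"
      using p permutation_entry(2)[OF perm] unfolding hessenberg_def by blast
  qed (use p in blast)
qed

subsection \<open>Valid hook configurations\<close>

lemma mem_hook_curve:
  "(x, y) \<in> hook_curve p (d, j) \<longleftrightarrow>
     x = real d \<and> real (entry p d) \<le> y \<and> y \<le> real (entry p j) \<or>
     real d \<le> x \<and> x \<le> real j \<and> y = real (entry p j)"
  by (auto simp: hook_curve_def sw_endpoint_def ne_endpoint_def plot_point_def)

lemma hooks_compatible_sym: "hooks_compatible p g h \<longleftrightarrow> hooks_compatible p h g"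
  unfolding hooks_compatible_def by blast

text \<open>A common point lies to the right of \<open>d\<close>, hence on the horizontal part of
  the first hook. If the second hook ends earlier, it stays strictly below that part; if it starts
  at \<open>j\<close> or later, the hooks can only touch at \<open>j = d'\<close>.\<close>

lemma hooks_compatible_iff:
  assumes d: "d < d'" "d' < j'" "entry p d' < entry p j'"
    and max: "\<And>x. d \<le> x \<Longrightarrow> x < j \<Longrightarrow> entry p x < entry p j"
      "\<And>x. d' \<le> x \<Longrightarrow> x < j' \<Longrightarrow> entry p x < entry p j'"
  shows "hooks_compatible p (d, j) (d', j') \<longleftrightarrow> j \<le> d' \<or> j' < j"
proof
  assume compat: "hooks_compatible p (d, j) (d', j')"
  show "j \<le> d' \<or> j' < j"
  proof (rule ccontr)
    assume "\<not> ?thesis"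
    then have a: "d' < j" "j \<le> j'" by auto
    have "entry p d' < entry p j" using max(1)[of d'] d a by simp
    moreover have "entry p j \<le> entry p j'" using max(2)[of j] a by (cases "j = j'") auto
    \<comment> \<open>Here the vertical part of the later hook meets the horizontal part of the
      earlier one. As \<open>d < d' < j\<close>, this is not a permitted shared endpoint.\<close>
    ultimately have "(real d', real (entry p j)) \<in> hook_curve p (d, j) \<inter> hook_curve p (d', j')"
      using d a by (simp add: mem_hook_curve)
    then have "(real d', real (entry p j)) = plot_point p j \<and>
          (real d', real (entry p j)) = plot_point p d' \<or>
        (real d', real (entry p j)) = plot_point p d \<and>
          (real d', real (entry p j)) = plot_point p j'"
      using compat unfolding hooks_compatible_def ne_endpoint_def sw_endpoint_def fst_conv snd_conv
      by blast
    then show False using d a by (auto simp: plot_point_def)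
  qed
next
  assume a: "j \<le> d' \<or> j' < j"
  show "hooks_compatible p (d, j) (d', j')"
    unfolding hooks_compatible_def
  proof
    fix z assume z: "z \<in> hook_curve p (d, j) \<inter> hook_curve p (d', j')"
    obtain x y where xy: "z = (x, y)" by force
    have x: "real d' \<le> x" "x \<le> real j'" "y \<le> real (entry p j')"
      using z d unfolding xy Int_iff mem_hook_curve by auto
    then have "x \<noteq> real d" using d by simp
    then have y: "x \<le> real j" "y = real (entry p j)"
      using z unfolding xy Int_iff mem_hook_curve by auto
    have "\<not> j' < j" if "d < j'"
    proof
      assume "j' < j"
      then have "entry p j' < entry p j" using max(1)[of j'] d by simp
      then show False using x y by simp
    qed
    then have "j \<le> d'" using a d by simp
    then have "x = real j" "j = d'" using x y by auto
    then show "(z = ne_endpoint p (d, j) \<and> z = sw_endpoint p (d', j')) \<or>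
        (z = sw_endpoint p (d, j) \<and> z = ne_endpoint p (d', j'))"
      using y by (simp add: xy ne_endpoint_def sw_endpoint_def plot_point_def)
  qed
qed

text \<open>Only the horizontal part matters: the vertical part begins at the plot point of its own
  column, so that point is not above it.\<close>

lemma hook_below_iff:
  assumes "1 \<le> d" "d < j" "j \<le> length p" "entry p d < entry p j"
  shows "(\<forall>z\<in>plot p. \<not> directly_above z (hook_curve p (d, j))) \<longleftrightarrow>
     (\<forall>x. d \<le> x \<longrightarrow> x \<le> j \<longrightarrow> entry p x \<le> entry p j)" (is "?L \<longleftrightarrow> ?R")
proof
  assume L: ?L
  show ?R
  proof (intro allI impI)
    fix x assume x: "d \<le> x" "x \<le> j"
    have "plot_point p x \<in> plot p" using x assms by (simp add: plot_def)
    then have "\<not> directly_above (plot_point p x) (hook_curve p (d, j))" using L by blast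
    moreover have "(real x, real (entry p j)) \<in> hook_curve p (d, j)"
      using x by (simp add: mem_hook_curve)
    ultimately show "entry p x \<le> entry p j"
      by (force simp: directly_above_def plot_point_def)
  qed
next
  assume R: ?R
  show ?L
  proof
    fix z assume "z \<in> plot p"
    then obtain x where z: "z = (real x, real (entry p x))" by (auto simp: plot_def plot_point_def)
    show "\<not> directly_above z (hook_curve p (d, j))"
    proof
      assume "directly_above z (hook_curve p (d, j))"
      then obtain y where y: "(real x, y) \<in> hook_curve p (d, j)" "y < real (entry p x)"
        by (auto simp: directly_above_def z)
      then consider "x = d" "real (entry p d) \<le> y" | "d \<le> x" "x \<le> j" "y = real (entry p j)"
        unfolding mem_hook_curve by auto
      then show False
      proof cases
        case 2
        then show False using R y(2) by (metis not_le of_nat_le_iff)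
      qed (use y in simp)
    qed
  qed
qed

text \<open>A position not entered by a descent has \<open>f j \<ge> j\<close> by
  \<open>hessenberg_small_entry\<close>, while earlier entries are at most \<open>j\<close> and
  differ from \<open>f j\<close>. So it is a left-to-right maximum.\<close>

lemma hessenberg_record:
  assumes h: "hessenberg n f" and j: "1 \<le> j" "j \<le> n" "\<And>i. j = Suc i \<Longrightarrow> 1 \<le> i \<Longrightarrow> f i < f j"
    and x: "1 \<le> x" "x < j"
  shows "f x < f j"
proof -
  have "\<not> f j < j"
  proof
    assume "f j < j"
    then have *: "1 < j \<and> f (j - 1) = j" using hessenberg_small_entry[OF h] j by simp
    then obtain i where "j = Suc i" "1 \<le> i" by (cases j) auto
    then show False using j(3)[of i] * \<open>f j < j\<close> by simp
  qed
  moreover have "f x \<le> Suc x" using hessenbergD(3)[OF h, of x] x j by simp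
  moreover have "f x \<noteq> f j" using inj_onD[OF hessenbergD(1)[OF h], of x j] x j by auto
  ultimately show ?thesis using x by linarith
qed

section \<open>Valid configurations as noncrossing matchings of the descents\<close>

lemma finite_descents [simp]: "finite (descents p)"
  by (rule finite_subset[of _ "{..length p}"]) (auto simp: descents_def)

definition hook_list :: "nat set \<Rightarrow> (nat \<Rightarrow> nat) \<Rightarrow> (nat \<times> nat) list" where
  "hook_list D q = map (\<lambda>d. (d, q d)) (sorted_list_of_set D)"

lemma set_hook_list: "finite D \<Longrightarrow> set (hook_list D q) = (\<lambda>d. (d, q d)) ` D"
  by (simp add: hook_list_def)

text \<open>A right end just after a descent would lie lower than the descent top, which is a point
  under the hook or its start. Conversely, any other right end is a left-to-right maximum by
  \<open>hessenberg_record\<close>. Either way right ends exceed all entries before them on their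
  hooks, so \<open>hooks_compatible_iff\<close> translates condition (3).\<close>

lemma valid_hook_list:
  assumes p: "p \<in> permutations_of_set {1..n}" and h: "hessenberg n (entry p)"
  defines "D \<equiv> descents p"
  shows "valid_hook_configuration p (hook_list D q) \<longleftrightarrow>
    noncrossing D q \<and> q ` D \<subseteq> {1..n} \<and> q ` D \<inter> Suc ` D = {}" (is "?L \<longleftrightarrow> ?R")
proof -
  have len: "length p = n" using permutation_entry(1)[OF p] .
  have fin: "finite D" by (simp add: D_def)
  have D: "d \<in> D \<longleftrightarrow> 1 \<le> d \<and> d < n \<and> entry p (Suc d) < entry p d" for d
    by (simp add: D_def descents_def len)
  let ?s = "sorted_list_of_set D"
  have s: "length ?s = card D" "distinct ?s" "set ?s = D" using fin by auto
  have L: "?L \<longleftrightarrow> (\<forall>d\<in>D. is_hook p (d, q d)) \<and>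
      (\<forall>d\<in>D. \<forall>z\<in>plot p. \<not> directly_above z (hook_curve p (d, q d))) \<and>
      (\<forall>d\<in>D. \<forall>d'\<in>D. d \<noteq> d' \<longrightarrow> hooks_compatible p (d, q d) (d', q d'))"
  proof -
    have 1: "length (hook_list D q) = card (descents p)"
      "\<forall>a<length (hook_list D q). sw_endpoint p (hook_list D q ! a) =
         plot_point p (sorted_list_of_set (descents p) ! a)"
      using s by (simp_all add: hook_list_def sw_endpoint_def D_def)
    have 2: "(\<forall>a<length (hook_list D q). \<forall>b<length (hook_list D q). a \<noteq> b \<longrightarrow>
         hooks_compatible p (hook_list D q ! a) (hook_list D q ! b)) \<longleftrightarrow>
       (\<forall>d\<in>D. \<forall>d'\<in>D. d \<noteq> d' \<longrightarrow> hooks_compatible p (d, q d) (d', q d'))" (is "?A \<longleftrightarrow> ?B")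
    proof
      assume A: ?A
      show ?B
      proof (intro ballI impI)
        fix d d' assume "d \<in> D" "d' \<in> D" "d \<noteq> d'"
        then obtain a b where "a < card D" "b < card D" "?s ! a = d" "?s ! b = d'"
          using s by (metis in_set_conv_nth)
        then show "hooks_compatible p (d, q d) (d', q d')"
          using A[rule_format, of a b] \<open>d \<noteq> d'\<close> s(1) by (auto simp: hook_list_def)
      qed
    next
      assume B: ?B
      show ?A
      proof (intro allI impI)
        fix a b assume ab: "a < length (hook_list D q)" "b < length (hook_list D q)" "a \<noteq> b"
        then have "?s ! a \<in> D" "?s ! b \<in> D" "?s ! a \<noteq> ?s ! b"
          using s nth_mem[of _ ?s] by (auto simp: hook_list_def nth_eq_iff_index_eq)
        then show "hooks_compatible p (hook_list D q ! a) (hook_list D q ! b)"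
          using B ab by (simp add: hook_list_def)
      qed
    qed
    have "?L \<longleftrightarrow> (\<forall>h\<in>set (hook_list D q). is_hook p h) \<and>
        (\<forall>z\<in>plot p. \<forall>h\<in>set (hook_list D q). \<not> directly_above z (hook_curve p h)) \<and>
        (\<forall>d\<in>D. \<forall>d'\<in>D. d \<noteq> d' \<longrightarrow> hooks_compatible p (d, q d) (d', q d'))"
      unfolding valid_hook_configuration_def 2 using 1 by blast
    then show ?thesis unfolding set_hook_list[OF fin] by blast
  qed
  show ?thesis
  proof
    assume valid: ?L
    have hook: "d < q d \<and> q d \<le> n \<and> entry p d < entry p (q d)" if "d \<in> D" for d
    proof -
      have "is_hook p (d, q d)" using valid that unfolding L by blast
      then show ?thesis by (simp add: is_hook_def len)
    qed
    have low: "entry p x \<le> entry p (q d)" if "d \<in> D" "d \<le> x" "x \<le> q d" for x d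
    proof -
      have "\<forall>z\<in>plot p. \<not> directly_above z (hook_curve p (d, q d))"
        using valid that(1) unfolding L by blast
      moreover have "1 \<le> d" using D that(1) by blast
      ultimately show ?thesis
        using hook_below_iff[of d "q d" p] hook[OF that(1)] that(2,3) len by blast
    qed
    have mx: "entry p x < entry p (q d)" if "d \<in> D" "d \<le> x" "x < q d" for x d
    proof -
      have "entry p x \<noteq> entry p (q d)"
      proof
        assume "entry p x = entry p (q d)"
        moreover have "x \<in> {1..n}" "q d \<in> {1..n}" using hook[OF that(1)] that D[of d] by simp_all
        ultimately have "x = q d" by (rule inj_onD[OF hessenbergD(1)[OF h]])
        then show False using that(3) by simp
      qed
      then show ?thesis using low[of d x] that by simp
    qed
    have "q d \<notin> Suc ` D" if "d \<in> D" for d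
    proof
      assume "q d \<in> Suc ` D"
      then obtain e where e: "e \<in> D" "q d = Suc e" by blast
      then have "entry p (Suc e) < entry p e" using D by blast
      moreover have "d \<le> e" using hook[OF that] e(2) by simp
      ultimately show False using mx[OF that, of e] e(2) by simp
    qed
    moreover have "q d \<in> {1..n}" if "d \<in> D" for d using hook[OF that] by simp
    moreover have "q d \<le> d' \<or> q d' < q d" if "d \<in> D" "d' \<in> D" "d < d'" for d d'
    proof -
      have "hooks_compatible p (d, q d) (d', q d')" using valid that unfolding L by (metis less_irrefl)
      then show ?thesis
        using hooks_compatible_iff[of d d' "q d'" p "q d"] hook mx that by blast
    qed
    ultimately show ?R unfolding noncrossing_def using hook by blast
  next
    assume R: ?R
    have q: "d < q d" "q d \<le> n" "q d \<notin> Suc ` D" if "d \<in> D" for d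
      using R that unfolding noncrossing_def by auto
    have mx: "entry p x < entry p (q d)" if d: "d \<in> D" and x: "d \<le> x" "x < q d" for x d
    proof (rule hessenberg_record[OF h])
      show "1 \<le> q d" "q d \<le> n" using q(1,2)[OF d] by simp_all
      show "1 \<le> x" using D[THEN iffD1, OF d] x(1) by simp
      fix i assume i: "q d = Suc i" "1 \<le> i"
      then have "i \<notin> D" using q(3)[OF d] by blast
      then have "\<not> entry p (Suc i) < entry p i" using D[of i] i q(2)[OF d] by simp
      moreover have "entry p i \<noteq> entry p (Suc i)"
        using inj_onD[OF hessenbergD(1)[OF h], of i "Suc i"] i q(2)[OF d] by auto
      ultimately show "entry p i < entry p (q d)" using i by simp
    qed (rule x)
    show ?L unfolding L
    proof (intro conjI ballI impI)
      fix d assume d: "d \<in> D"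
      then show "is_hook p (d, q d)"
        using q(1,2)[OF d] mx[OF d, of d] D[THEN iffD1, OF d] by (simp add: is_hook_def len)
    next
      fix d z assume d: "d \<in> D" and z: "z \<in> plot p"
      have "entry p x \<le> entry p (q d)" if "d \<le> x" "x \<le> q d" for x
        using mx[OF d, of x] that by (cases "x = q d") auto
      then show "\<not> directly_above z (hook_curve p (d, q d))"
        using hook_below_iff[of d "q d" p] z q(1,2)[OF d] mx[OF d, of d] D[THEN iffD1, OF d]
        unfolding len by blast
    next
      fix d d' assume d: "d \<in> D" "d' \<in> D" "d \<noteq> d'"
      have *: "hooks_compatible p (a, q a) (b, q b)" if "a \<in> D" "b \<in> D" "a < b" for a b
      proof -
        have "q a \<le> b \<or> q b < q a" using R that unfolding noncrossing_def by blast
        then show ?thesis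
          using hooks_compatible_iff[OF that(3) q(1)[OF that(2)] mx[OF that(2)] mx[OF that(1)] mx[OF that(2)]]
            q(1)[OF that(2)] by blast
      qed
      show "hooks_compatible p (d, q d) (d', q d')"
        using *[of d d'] *[of d' d] d hooks_compatible_sym by (cases d d' rule: linorder_cases) blast+
    qed
  qed
qed

text \<open>Condition (1) fixes the first components as the descents in increasing order. They are
  distinct, so \<open>map_of\<close> recovers the right ends.\<close>

lemma valid_hook_configuration_is_hook_list:
  assumes "valid_hook_configuration p hs"
  obtains q where "hs = hook_list (descents p) q"
proof -
  let ?s = "sorted_list_of_set (descents p)"
  have "map fst hs = ?s"
  proof (rule nth_equalityI)
    show "length (map fst hs) = length ?s"
      using assms by (simp add: valid_hook_configuration_def)
    fix a assume "a < length (map fst hs)"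
    then show "map fst hs ! a = ?s ! a"
      using assms
      by (simp add: valid_hook_configuration_def sw_endpoint_def plot_point_def)
  qed
  moreover from this have "distinct (map fst hs)" by simp
  then have "map (\<lambda>h. (fst h, the (map_of hs (fst h)))) hs = hs"
    by (intro map_idI) auto
  ultimately have "hs = hook_list (descents p) (\<lambda>d. the (map_of hs d))"
    unfolding hook_list_def by (metis (no_types, lifting) comp_apply map_eq_conv map_map)
  then show ?thesis by (rule that)
qed

section \<open>The bijection between configurations and balanced words\<close>

definition encode :: "nat \<Rightarrow> nat list \<times> (nat \<times> nat) list \<Rightarrow> (bool \<times> bool) list" where
  "encode n c = word (\<lambda>i. entry (fst c) i = Suc i) (\<lambda>i. i \<in> snd ` set (snd c)) n"

lemma VHC_of_Av_iff:
  "(p, hs) \<in> VHC_of (Av n {[3, 1, 2], [3, 2, 1]}) \<longleftrightarrow>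
    p \<in> permutations_of_set {1..n} \<and> hessenberg n (entry p) \<and>
    (\<exists>q. hs = hook_list (descents p) q \<and> noncrossing (descents p) q \<and>
       q ` descents p \<subseteq> {1..n} \<and> q ` descents p \<inter> Suc ` descents p = {})" (is "?L \<longleftrightarrow> ?P \<and> ?H \<and> ?Q")
proof -
  have "?L \<longleftrightarrow> ?P \<and> ?H \<and> valid_hook_configuration p hs"
    unfolding VHC_of_def VHC_def Av_312_321 by auto
  also have "\<dots> \<longleftrightarrow> ?P \<and> ?H \<and> ?Q"
  proof (intro conj_cong refl)
    assume p: ?P ?H
    show "valid_hook_configuration p hs \<longleftrightarrow> ?Q"
      using valid_hook_list[OF p] valid_hook_configuration_is_hook_list[of p hs] by metis
  qed
  finally show ?thesis .
qed

lemma descents_hessenberg: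
  assumes "p \<in> permutations_of_set {1..n}" "hessenberg n (entry p)" "d < n"
  shows "d \<in> descents p \<longleftrightarrow> 1 \<le> d \<and> entry p d = Suc d \<and> entry p (Suc d) \<noteq> Suc (Suc d)"
proof -
  have "d \<in> descents p \<longleftrightarrow> 1 \<le> d \<and> entry p (Suc d) < entry p d"
    using assms(3) permutation_entry(1)[OF assms(1)] by (simp add: descents_def)
  then show ?thesis using hessenberg_descent[OF assms(2) _ assms(3)] by auto
qed

lemma descents_subset: "p \<in> permutations_of_set {1..n} \<Longrightarrow> descents p \<subseteq> {1..<n}"
  using permutation_entry(1)[of p n] by (auto simp: descents_def)

lemma snd_hook_list: "finite D \<Longrightarrow> snd ` set (hook_list D q) = q ` D"
  by (simp add: set_hook_list image_image)

text \<open>The first components of the letters determine the permutation by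
  \<open>hessenberg_unique\<close>, hence its descents. The second components give the set of right
  ends, from which \<open>noncrossing_partner\<close> recovers the hooks.\<close>

lemma inj_on_encode: "inj_on (encode n) (VHC_of (Av n {[3, 1, 2], [3, 2, 1]}))"
proof (rule inj_onI, clarify)
  fix p hs p' hs'
  assume a: "(p, hs) \<in> VHC_of (Av n {[3, 1, 2], [3, 2, 1]})"
    and a': "(p', hs') \<in> VHC_of (Av n {[3, 1, 2], [3, 2, 1]})"
    and eq: "encode n (p, hs) = encode n (p', hs')"
  from a obtain q where p: "p \<in> permutations_of_set {1..n}" "hessenberg n (entry p)"
    and q: "hs = hook_list (descents p) q" "noncrossing (descents p) q" "q ` descents p \<subseteq> {1..n}"
    unfolding VHC_of_Av_iff by blast
  from a' obtain q' where p': "p' \<in> permutations_of_set {1..n}" "hessenberg n (entry p')"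
    and q': "hs' = hook_list (descents p') q'" "noncrossing (descents p') q'" "q' ` descents p' \<subseteq> {1..n}"
    unfolding VHC_of_Av_iff by blast
  have e: "entry p i = Suc i \<longleftrightarrow> entry p' i = Suc i"
      "i \<in> q ` descents p \<longleftrightarrow> i \<in> q' ` descents p'" if "i \<in> {1..n}" for i
    using eq that unfolding encode_def word_eq_iff q(1) q'(1) fst_conv snd_conv
      snd_hook_list[OF finite_descents] by blast+
  have ent: "entry p i = entry p' i" if "i \<in> {1..n}" for i
    by (rule hessenberg_unique[OF p(2) p'(2) e(1) that])
  have len: "length p = n" "length p' = n" using permutation_entry(1) p(1) p'(1) by blast+
  have "p = p'"
  proof (rule nth_equalityI)
    fix i assume "i < length p"
    then show "p ! i = p' ! i" using ent[of "Suc i"] len by (simp add: entry_def)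
  qed (simp add: len)
  moreover have "hs = hs'"
  proof -
    have im: "q ` descents p = q' ` descents p" using e(2) q(3) q'(3) \<open>p = p'\<close> by blast
    have "q d = q' d" if "d \<in> descents p" for d
    proof -
      have "q d = partner (descents p) (q ` descents p) d"
        by (rule noncrossing_partner[OF q(2) that, symmetric])
      also have "\<dots> = q' d"
        unfolding im by (rule noncrossing_partner) (use q'(2) that \<open>p = p'\<close> in auto)
      finally show ?thesis .
    qed
    then show ?thesis unfolding q(1) q'(1) hook_list_def \<open>p = p'\<close>[symmetric] by simp
  qed
  ultimately show "p = p' \<and> hs = hs'" by blast
qed

text \<open>Heights of a configuration count hooks and so are nonnegative, the last entry cannot be
  \<open>Suc n\<close>, and there are as many right ends as descents. For the converse,
  \<open>hessenberg_exists\<close> builds the permutation from the first components, and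
  \<open>partner\<close> builds the hooks from the second.\<close>

lemma encode_image:
  assumes n: "n \<ge> 1"
  shows "encode n ` VHC_of (Av n {[3, 1, 2], [3, 2, 1]}) =
    {w. length w = n \<and> admissible w \<and> \<not> in_block w \<and> ups w = closers w}" (is "?L = ?W")
proof (intro equalityI subsetI)
  fix w assume "w \<in> ?L"
  then obtain p hs where a: "(p, hs) \<in> VHC_of (Av n {[3, 1, 2], [3, 2, 1]})" and w: "w = encode n (p, hs)"
    by auto
  from a obtain q where p: "p \<in> permutations_of_set {1..n}" "hessenberg n (entry p)"
    and q: "hs = hook_list (descents p) q" "noncrossing (descents p) q" "q ` descents p \<subseteq> {1..n}"
      "q ` descents p \<inter> Suc ` descents p = {}"
    unfolding VHC_of_Av_iff by blast
  define D where "D = descents p"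
  note q = q[folded D_def]
  have D: "D \<subseteq> {1..<n}" using descents_subset[OF p(1)] by (simp add: D_def)
  have w: "w = word (\<lambda>i. entry p i = Suc i) (\<lambda>i. i \<in> q ` D) n"
    by (simp add: w encode_def q(1) snd_hook_list D_def)
  have d: "i \<in> D \<longleftrightarrow> 1 \<le> i \<and> entry p i = Suc i \<and> entry p (Suc i) \<noteq> Suc (Suc i)" if "i < n" for i
    unfolding D_def by (rule descents_hessenberg[OF p that])
  have 0: "0 \<notin> q ` D" using q(3) by auto
  have "admissible w"
    unfolding w using admissible_word[of n D "\<lambda>i. entry p i = Suc i" "q ` D", OF d refl 0] q(4)
      height_image[OF q(2)] by auto
  moreover have "entry p n \<noteq> Suc n" using hessenbergD(5)[OF p(2), of n] n by simp
  then have "\<not> in_block w" unfolding w in_block_word by simp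
  moreover have "ups w = closers w"
  proof -
    have "ups w = card (D \<inter> {..<n})" unfolding w by (rule ups_word[OF d])
    also have "D \<inter> {..<n} = D" using D by auto
    also have "card D = card (q ` D)" using noncrossing_inj[OF q(2)] by (simp add: card_image)
    also have "q ` D = q ` D \<inter> {..n}" using q(3) by auto
    also have "card (q ` D \<inter> {..n}) = closers w" unfolding w by (rule closers_word[OF refl 0, symmetric])
    finally show ?thesis .
  qed
  ultimately show "w \<in> ?W" by (simp add: w)
next
  fix w assume W: "w \<in> ?W"
  then obtain b c where w: "w = word b c n" using word_exists by blast
  have adm: "admissible (word b c n)" and bn: "\<not> b n" and bal: "ups (word b c n) = closers (word b c n)"
    using W n by (simp_all add: w in_block_word)
  obtain p where p: "p \<in> permutations_of_set {1..n}" "hessenberg n (entry p)"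
    and b: "\<And>i. i \<in> {1..n} \<Longrightarrow> entry p i = Suc i \<longleftrightarrow> b i"
    using hessenberg_exists[of n b, OF n bn] by blast
  define D where "D = descents p"
  define C where "C = {i\<in>{1..n}. c i}"
  have D: "D \<subseteq> {1..<n}" using descents_subset[OF p(1)] by (simp add: D_def)
  have d: "i \<in> D \<longleftrightarrow> 1 \<le> i \<and> b i \<and> \<not> b (Suc i)" if "i < n" for i
    unfolding D_def descents_hessenberg[OF p that] using b[of i] b[of "Suc i"] that
    by (cases "1 \<le> i") simp_all
  have c: "i \<in> C \<longleftrightarrow> c i" if "1 \<le> i" "i \<le> n" for i using that by (simp add: C_def)
  have 0: "0 \<notin> C" by (simp add: C_def)
  have adm': "\<forall>v\<le>n. height D C v \<ge> 0 \<and> (v \<in> C \<longrightarrow> v \<notin> Suc ` D)"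
    using adm admissible_word[of n D b C c, OF d c 0] by blast
  have "card D = card C"
  proof -
    have "D \<inter> {..<n} = D" "C \<inter> {..n} = C" using D by (auto simp: C_def)
    then show ?thesis using bal ups_word[of n D b c, OF d] closers_word[of n C c b, OF c 0] by simp
  qed
  have C: "C \<subseteq> {1..n}" by (auto simp: C_def)
  have disj: "C \<inter> Suc ` D = {}"
  proof -
    have "v \<notin> Suc ` D" if "v \<in> C" for v
    proof -
      have "v \<le> n" using that by (simp add: C_def)
      with adm' that show ?thesis by blast
    qed
    then show ?thesis by blast
  qed
  have "height D C v \<ge> 0" if "v \<le> n" for v using adm' that by blast
  note nc = partner_properties[OF D C \<open>card D = card C\<close>[symmetric] this disj]
  let ?hs = "hook_list D (partner D C)"
  have "(p, ?hs) \<in> VHC_of (Av n {[3, 1, 2], [3, 2, 1]})"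
    unfolding VHC_of_Av_iff using p nc C disj unfolding D_def by metis
  moreover have "encode n (p, ?hs) = w"
    unfolding w encode_def word_eq_iff fst_conv snd_conv
    using b c nc(2) snd_hook_list[of D "partner D C"] by (simp add: D_def)
  ultimately show "w \<in> ?L" by (metis imageI)
qed

theorem theorem6:
  fixes n :: nat
  assumes "n \<ge> 1"
  shows "real (card (VHC_of (Av n {[3, 1, 2], [3, 2, 1]}))) =
    (\<Sum>k = 0..(n - 1) div 2.
       1 / real (2 * k + 1) * real ((n - k - 1) choose k) * real (n choose (2 * k)))"
  using card_balanced_words[OF assms] card_image[OF inj_on_encode, of n]
  unfolding encode_image[OF assms] by simp

end
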